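(* Let $w$ be an integrable weight function on $[-1,1]$ with $w(x)>0$ almost everywhere, and let $t_1,\ldots,t_n,t_{n+1}\in(-1,1)$ be distinct. Then: (1) The zeros of $r_n(t_1,\ldots,t_n;x)$ and $r_{n+1}(t_1,\ldots,t_n,t_{n+1};x)$ on $[-1,1]$ are strictly interlacing. (2) The zeros of $r_n(t_1,\ldots,t_{n-1},t_n;x)$ and $r_n(t_1,\ldots,t_{n-1},t_{n+1};x)$ on $[-1,1]$ are strictly interlacing. (3) For every $i$ with $1\le i\le n-1$, the zeros of $r_n(t_1,\ldots,t_{i-1},t_{i+1},\ldots,t_n,t_i;x)$ and $r_n(t_1,\ldots,t_n;x)$ are strictly interlacing.
   Context: For $m\ge1$ and distinct $s_1,\ldots,s_m\in(-1,1)$, $r_m(s_1,\ldots,s_m;x)=\frac{1}{1+s_mx}+\sum_{j=1}^{m-1}\frac{c_j}{1+s_jx}$, where the real numbers $c_1,\ldots,c_{m-1}$ are chosen so that $\int_{-1}^1 r_m(s_1,\ldots,s_m;x)\frac{w(x)}{1+s_jx}\,dx=0$ for $j=1,\ldots,m-1$ (so the last parameter plays a distinguished role). Such a function has precisely $m-1$ zeros on $[-1,1]$; they are simple and lie in $(-1,1)$. Two finite sets of zeros are strictly interlacing if they have no point in common and between any two consecutive points of either set there is exactly one point of the other set. *)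

theory Defs
  imports "HOL-Analysis.Analysis"
begin

definition positive_weight :: "(real \<Rightarrow> real) \<Rightarrow> bool" where
  "positive_weight w \<longleftrightarrow>
     set_integrable lebesgue {-1..1} w \<and>
     (AE x in lebesgue. x \<in> {-1..1} \<longrightarrow> w x > 0)"

text \<open>Parameters and coefficients are families indexed from 1; only the parameters
  \<open>s 1, \<dots>, s m\<close> and the coefficients \<open>c 1, \<dots>, c (m - 1)\<close> are used.\<close>

definition rat_comb :: "nat \<Rightarrow> (nat \<Rightarrow> real) \<Rightarrow> (nat \<Rightarrow> real) \<Rightarrow> real \<Rightarrow> real" where
  "rat_comb m s c x = 1 / (1 + s m * x) + (\<Sum>j = 1..m - 1. c j / (1 + s j * x))"

definition orth_coeffs :: "(real \<Rightarrow> real) \<Rightarrow> nat \<Rightarrow> (nat \<Rightarrow> real) \<Rightarrow> (nat \<Rightarrow> real) \<Rightarrow> bool" where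
  "orth_coeffs w m s c \<longleftrightarrow>
     (\<forall>j \<in> {1..m - 1}.
        (LINT x:{-1..1}|lebesgue. rat_comb m s c x * (w x / (1 + s j * x))) = 0)"

text \<open>For a positive weight and distinct parameters in \<open>(-1, 1)\<close> the orthogonality conditions
  form a linear system with nonsingular (Gram) matrix, so they determine
  \<open>c 1, \<dots>, c (m - 1)\<close> uniquely; the remaining values of \<open>c\<close> are arbitrary,
  which is why the choice is made with \<open>SOME\<close> rather than \<open>THE\<close>.\<close>

definition orth_rat :: "(real \<Rightarrow> real) \<Rightarrow> nat \<Rightarrow> (nat \<Rightarrow> real) \<Rightarrow> real \<Rightarrow> real" where
  "orth_rat w m s = rat_comb m s (SOME c. orth_coeffs w m s c)"

definition zeros :: "(real \<Rightarrow> real) \<Rightarrow> real set" where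
  "zeros f = {x \<in> {-1..1}. f x = 0}"

definition consecutive_in :: "real set \<Rightarrow> real \<Rightarrow> real \<Rightarrow> bool" where
  "consecutive_in A a b \<longleftrightarrow> a \<in> A \<and> b \<in> A \<and> a < b \<and> A \<inter> {a<..<b} = {}"

definition strictly_interlacing :: "real set \<Rightarrow> real set \<Rightarrow> bool" where
  "strictly_interlacing A B \<longleftrightarrow>
     finite A \<and> finite B \<and> A \<inter> B = {} \<and>
     (\<forall>a b. consecutive_in A a b \<longrightarrow> (\<exists>!y. y \<in> B \<and> a < y \<and> y < b)) \<and>
     (\<forall>a b. consecutive_in B a b \<longrightarrow> (\<exists>!y. y \<in> A \<and> a < y \<and> y < b))"

end

theory Submission
  imports Defs
begin

text \<open>
  Each of the three pairs consists of two functions \<open>f\<close>, \<open>g\<close> in the span \<open>V S\<close> of the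
  fractions \<open>1 / (1 + s * x)\<close>, \<open>s \<in> S\<close>, that are linearly independent and orthogonal (with
  weight \<open>w\<close>) to \<open>V T\<close> for a set \<open>T\<close> with only two points fewer than \<open>S\<close>. In (1) and (2),
  \<open>S\<close> consists of \<open>t 1, \<dots>, t (n + 1)\<close> and \<open>T\<close> of \<open>t 1, \<dots>, t (n - 1)\<close>; in (3),
  \<open>S\<close> consists of \<open>t 1, \<dots>, t n\<close>, and \<open>T\<close> arises from it by removing \<open>t i\<close> and \<open>t n\<close>.
  Interlacing holds for every such pair (\<open>strictly_interlacing_if_orthogonal\<close>).

  Put \<open>f\<close> and \<open>g\<close> over their common denominator, which is positive on \<open>[-1, 1]\<close>. If the Wronskian
  of the two numerators vanished at a real point \<open>y\<close>, then some nontrivial combination \<open>h\<close> of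
  \<open>f\<close> and \<open>g\<close> would have a numerator \<open>(x - y)\<^sup>2 * q x\<close> with \<open>degree q < card T\<close>. By partial
  fractions, \<open>q\<close> divided by the product of the \<open>1 + s * x\<close>, \<open>s \<in> T\<close>, lies in \<open>V T\<close>, so it is
  orthogonal to \<open>h\<close>. But the product of the two is \<open>(x - y)\<^sup>2 * (q x)\<^sup>2\<close> divided by something
  positive, and its weighted integral is positive (\<open>no_double_root_if_orthogonal\<close>).

  Where the Wronskian does not vanish, the derivatives of \<open>f / g\<close> and \<open>g / f\<close> do not vanish
  either, so by Rolle's theorem two zeros of one function always enclose a zero of the other
  (\<open>Rolle_Wronskian\<close>). This is strict interlacing.

  As the functions in the theorem are given by a choice of coefficients, it must also be shown that
  coefficients satisfying the orthogonality conditions exist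
  (\<open>exists_orthogonal_projection\<close>).
\<close>

section \<open>Interlacing from a nonvanishing Wronskian\<close>

text \<open>If \<open>g\<close> had no zero between the zeros \<open>a\<close>, \<open>b\<close> of \<open>f\<close>, then \<open>f / g\<close> would be differentiable
  on \<open>[a, b]\<close> with equal values at the ends, and its derivative is the negated Wronskian over
  \<open>g\<^sup>2\<close>.\<close>

lemma Rolle_Wronskian:
  fixes f g f' g' :: "real \<Rightarrow> real"
  assumes f: "\<And>x. (f has_real_derivative f' x) (at x)"
    and g: "\<And>x. (g has_real_derivative g' x) (at x)"
    and W: "\<And>x. f x * g' x - f' x * g x \<noteq> 0"
    and ab: "a < b" "f a = 0" "f b = 0"
  shows "\<exists>y. a < y \<and> y < b \<and> g y = 0"
proof (rule ccontr)
  assume no: "\<not> ?thesis"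
  have "g a \<noteq> 0" using W[of a] ab by auto
  moreover have "g b \<noteq> 0" using W[of b] ab by auto
  ultimately have nz: "g x \<noteq> 0" if "x \<in> {a..b}" for x
    using no that by (cases "x = a \<or> x = b") (auto simp: less_le)
  have D: "((\<lambda>x. f x / g x) has_real_derivative (f' x * g x - f x * g' x) / (g x * g x)) (at x)"
    if "x \<in> {a..b}" for x
    using DERIV_divide[OF f g nz[OF that]] .
  have "continuous_on {a..b} (\<lambda>x. f x / g x)"
    using D DERIV_isCont by (intro continuous_at_imp_continuous_on) blast
  then obtain z where z: "a < z" "z < b" "((\<lambda>x. f x / g x) has_real_derivative 0) (at z)"
    using Rolle[of a b "\<lambda>x. f x / g x"] ab D
    by (metis atLeastAtMost_iff div_0 less_imp_le real_differentiable_def)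
  then have "(f' z * g z - f z * g' z) / (g z * g z) = 0"
    using D[of z] by (meson DERIV_unique atLeastAtMost_iff less_imp_le)
  then show False using nz[of z] W[of z] z by auto
qed

text \<open>The Wronskian condition is symmetric in \<open>p\<close> and \<open>q\<close>. Applied one way round, the preceding lemma
  gives a zero between consecutive zeros; applied the other way round, it shows that a second one
  would enclose a further zero of the first polynomial.\<close>

lemma strictly_interlacing_if_Wronskian_nonzero:
  fixes p q :: "real poly"
  assumes W: "\<And>x. poly p x * poly (pderiv q) x - poly (pderiv p) x * poly q x \<noteq> 0"
  shows "strictly_interlacing (zeros (poly p)) (zeros (poly q))"
proof -
  have W': "poly q x * poly (pderiv p) x - poly (pderiv q) x * poly p x \<noteq> 0" for x
    using W[of x] by (simp add: algebra_simps)
  have fin: "finite (zeros (poly r))" if "r \<noteq> 0" for r :: "real poly"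
    using poly_roots_finite[OF that] by (simp add: zeros_def)
  have between: "\<exists>!y. y \<in> zeros (poly s) \<and> a < y \<and> y < b"
    if WR: "\<And>x. poly r x * poly (pderiv s) x - poly (pderiv r) x * poly s x \<noteq> 0"
      and c: "consecutive_in (zeros (poly r)) a b" for r s a b
  proof -
    have WR': "poly s x * poly (pderiv r) x - poly (pderiv s) x * poly r x \<noteq> 0" for x
      using WR[of x] by (simp add: algebra_simps)
    have ab: "-1 \<le> a" "a < b" "b \<le> 1" "poly r a = 0" "poly r b = 0"
      and no: "\<And>x. a < x \<Longrightarrow> x < b \<Longrightarrow> poly r x \<noteq> 0"
      using c unfolding consecutive_in_def zeros_def by (auto simp: set_eq_iff)
    obtain y where y: "a < y" "y < b" "poly s y = 0"
      using Rolle_Wronskian[OF poly_DERIV poly_DERIV WR ab(2,4,5)] by blast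
    have uniq: False if "y1 < y2" "a < y1" "y2 < b" "poly s y1 = 0" "poly s y2 = 0" for y1 y2
      using Rolle_Wronskian[OF poly_DERIV poly_DERIV WR' that(1,4,5)] no that by force
    show ?thesis
    proof (rule ex1I[of _ y])
      show "z = y" if "z \<in> zeros (poly s) \<and> a < z \<and> z < b" for z
        using that uniq[of y z] uniq[of z y] y by (auto simp: zeros_def intro: linorder_cases)
    qed (use y ab in \<open>auto simp: zeros_def\<close>)
  qed
  have "p \<noteq> 0" "q \<noteq> 0" using W[of 0] by auto
  then show ?thesis
    unfolding strictly_interlacing_def
  proof (intro conjI allI impI)
    show "zeros (poly p) \<inter> zeros (poly q) = {}"
      using W by (auto simp: zeros_def)
        (metis diff_self mult_zero_left mult_zero_right)
  qed (use fin between[OF W] between[OF W'] in blast)+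
qed

section \<open>Sums of simple fractions\<close>

definition pole_sum :: "real set \<Rightarrow> (real \<Rightarrow> real) \<Rightarrow> real \<Rightarrow> real" where
  "pole_sum S c x = (\<Sum>s\<in>S. c s / (1 + s * x))"

definition pole_den :: "real set \<Rightarrow> real poly" where
  "pole_den S = (\<Prod>s\<in>S. [:1, s:])"

definition pole_num :: "real set \<Rightarrow> (real \<Rightarrow> real) \<Rightarrow> real poly" where
  "pole_num S c = (\<Sum>s\<in>S. smult (c s) (pole_den (S - {s})))"

lemma one_plus_mult_pos:
  fixes s x :: real
  assumes "s \<in> {-1<..<1}" "x \<in> {-1..1}"
  shows "1 + s * x > 0"
proof -
  have "\<bar>s * x\<bar> \<le> \<bar>s\<bar> * 1" unfolding abs_mult using assms by (intro mult_left_mono) auto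
  then show ?thesis using assms by auto
qed

lemma continuous_on_pole_sum [continuous_intros]:
  assumes "S \<subseteq> {-1<..<1}"
  shows "continuous_on {-1..1} (pole_sum S c)"
  unfolding pole_sum_def using assms one_plus_mult_pos
  by (intro continuous_intros) (force simp: subset_eq)

lemma pole_den_pos:
  assumes "S \<subseteq> {-1<..<1}" "x \<in> {-1..1}"
  shows "poly (pole_den S) x > 0"
  unfolding pole_den_def poly_prod
proof (rule prod_pos)
  fix s assume "s \<in> S"
  then show "poly [:1, s:] x > 0"
    using one_plus_mult_pos[of s x] assms by (auto simp: mult.commute)
qed

lemma pole_sum_eq_quotient:
  assumes "finite S" "S \<subseteq> {-1<..<1}" "x \<in> {-1..1}"
  shows "pole_sum S c x = poly (pole_num S c) x / poly (pole_den S) x"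
proof -
  have "c s / (1 + s * x) = c s * poly (pole_den (S - {s})) x / poly (pole_den S) x"
    if s: "s \<in> S" for s
  proof -
    have "pole_den S = [:1, s:] * pole_den (S - {s})"
      unfolding pole_den_def using assms s by (intro prod.remove) auto
    moreover have "poly (pole_den (S - {s})) x > 0"
      using assms by (intro pole_den_pos) auto
    moreover have "1 + s * x > 0" using one_plus_mult_pos[of s x] assms s by auto
    moreover have "poly ([:1, s:] * r) x = (1 + s * x) * poly r x" for r
      by (simp add: algebra_simps)
    ultimately show ?thesis by simp
  qed
  then show ?thesis
    unfolding pole_sum_def pole_num_def
    by (simp add: poly_sum sum_divide_distrib)
qed

lemma degree_pole_num:
  assumes "finite S"
  shows "degree (pole_num S c) \<le> card S - 1"
  unfolding pole_num_def
proof (rule degree_sum_le[OF assms])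
  fix s assume s: "s \<in> S"
  have "degree (pole_den (S - {s})) \<le> (\<Sum>r\<in>S - {s}. degree [:1, r:])"
    unfolding pole_den_def using degree_prod_sum_le[of "S - {s}" "\<lambda>r. [:1, r:]"] assms
    by (simp add: o_def)
  also have "\<dots> \<le> (\<Sum>r\<in>S - {s}. 1)" by (intro sum_mono) auto
  finally show "degree (smult (c s) (pole_den (S - {s}))) \<le> card S - 1"
    using assms s degree_smult_le[of "c s" "pole_den (S - {s})"] by simp
qed

text \<open>Linear independence of the simple fractions. The parameter 0, whose fraction has no pole, keeps
  one from evaluating the numerator at \<open>-1 / u\<close>. The reversed numerator \<open>R\<close>, whose value at
  \<open>1 / x\<close> vanishes with the sum, can be evaluated at \<open>-u\<close> for every parameter \<open>u\<close>, and only the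
  term of \<open>u\<close> survives there.\<close>

lemma finite_zeros_pole_sum:
  assumes "finite S" "u \<in> S" "c u \<noteq> 0" "S \<subseteq> {-1<..<1}"
  shows "finite (zeros (pole_sum S c))"
proof -
  define R where "R = (\<Sum>s\<in>S. smult (c s) (\<Prod>r\<in>S - {s}. [:r, 1:]))"
  have "(\<Sum>s\<in>S. c s * (\<Prod>r\<in>S - {s}. r - u)) = c u * (\<Prod>r\<in>S - {u}. r - u)"
  proof -
    have "(\<Sum>s\<in>S. c s * (\<Prod>r\<in>S - {s}. r - u))
        = (\<Sum>s\<in>S. if s = u then c u * (\<Prod>r\<in>S - {u}. r - u) else 0)"
      using assms by (intro sum.cong) auto
    then show ?thesis using assms by simp
  qed
  moreover have "poly R (-u) = (\<Sum>s\<in>S. c s * (\<Prod>r\<in>S - {s}. r - u))"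
    by (simp add: R_def poly_sum poly_prod)
  ultimately have "poly R (-u) \<noteq> 0" using assms by (auto simp: prod_zero_iff)
  then have fin: "finite {y. poly R y = 0}" by (intro poly_roots_finite) auto
  have "poly R (1 / x) = 0" if x: "x \<in> zeros (pole_sum S c)" "x \<noteq> 0" for x
  proof -
    have "(\<Prod>r\<in>S - {s}. r + 1 / x) = (\<Prod>r\<in>S. r + 1 / x) * x / (1 + s * x)"
      if s: "s \<in> S" for s
    proof -
      have "1 + s * x > 0"
        using one_plus_mult_pos[of s x] s assms x by (auto simp: zeros_def)
      moreover have "(\<Prod>r\<in>S. r + 1 / x) = (s + 1 / x) * (\<Prod>r\<in>S - {s}. r + 1 / x)"
        using assms s by (intro prod.remove) auto
      ultimately show ?thesis using x by (simp add: field_simps)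
    qed
    then have "poly R (1 / x) = (\<Sum>s\<in>S. (\<Prod>r\<in>S. r + 1 / x) * x * (c s / (1 + s * x)))"
      by (simp add: R_def poly_sum poly_prod mult_ac)
    also have "\<dots> = (\<Prod>r\<in>S. r + 1 / x) * x * pole_sum S c x"
      by (simp add: pole_sum_def sum_distrib_left)
    finally show ?thesis using x by (simp add: zeros_def)
  qed
  then have "zeros (pole_sum S c) \<subseteq> insert 0 ((\<lambda>y. 1 / y) ` {y. poly R y = 0})"
    by (force simp: image_iff)
  then show ?thesis using fin by (meson finite.insertI finite_imageI finite_subset)
qed

text \<open>Induction on \<open>T\<close>: write \<open>p x = a + x * p' x\<close>, apply the hypothesis to \<open>a\<close> and \<open>p'\<close>, and split
  the remaining products by
  \<open>(e + x * d) / ((1 + s * x) * (1 + u * x))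
    = ((e * s - d) / (1 + s * x) + (d - e * u) / (1 + u * x)) / (s - u)\<close>.
  This treats the parameter 0 like all others, which interpolation at the poles \<open>-1 / s\<close> would
  not.\<close>

lemma partial_fractions:
  assumes "finite T" "T \<subseteq> {-1<..<1}" "degree p < card T"
  shows "\<exists>d. \<forall>x\<in>{-1..1}. poly p x / poly (pole_den T) x = pole_sum T d x"
  using assms
proof (induction T arbitrary: p rule: finite_induct)
  case empty
  then show ?case by simp
next
  case (insert u T)
  have den: "poly (pole_den (insert u T)) x = (1 + u * x) * poly (pole_den T) x" for x
    using insert by (simp add: pole_den_def algebra_simps)
  obtain a p' where p: "p = pCons a p'" by (cases p)
  show ?case
  proof (cases "T = {}")
    case True
    then have "degree p = 0" using insert by simp
    then have "p = [:a:]" using p by (metis degree_pCons_eq_if nat.distinct(1))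
    then show ?thesis
      by (intro exI[of _ "\<lambda>_. a"]) (simp add: True pole_den_def pole_sum_def mult.commute)
  next
    case False
    have k: "card T > 0" using False insert by auto
    have T: "T \<subseteq> {-1<..<1}" using insert by auto
    have "degree p' < card T"
      using insert k unfolding p by (auto simp: degree_pCons_eq_if split: if_splits)
    from insert.IH[OF T this] obtain d
      where d: "\<And>x. x \<in> {-1..1} \<Longrightarrow> poly p' x / poly (pole_den T) x = pole_sum T d x" by blast
    have "degree [:a:] < card T" using k by simp
    from insert.IH[OF T this] obtain e
      where e: "\<And>x. x \<in> {-1..1} \<Longrightarrow> poly [:a:] x / poly (pole_den T) x = pole_sum T e x" by blast
    define \<gamma> where "\<gamma> s = (e s * s - d s) / (s - u)" for s
    define \<delta> where "\<delta> = (\<Sum>s\<in>T. (d s - e s * u) / (s - u))"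
    have "poly p x / poly (pole_den (insert u T)) x
        = pole_sum (insert u T) (\<lambda>s. if s = u then \<delta> else \<gamma> s) x"
      if x: "x \<in> {-1..1}" for x
    proof -
      have ux: "1 + u * x > 0" using one_plus_mult_pos[of u x] insert x by auto
      have "poly p x / poly (pole_den (insert u T)) x
          = (poly [:a:] x / poly (pole_den T) x + x * (poly p' x / poly (pole_den T) x)) / (1 + u * x)"
        by (simp add: den p add_divide_distrib mult.commute)
      also have "\<dots> = (pole_sum T e x + x * pole_sum T d x) / (1 + u * x)"
        by (simp only: d[OF x] e[OF x])
      also have "\<dots> = (\<Sum>s\<in>T. (e s + x * d s) / ((1 + s * x) * (1 + u * x)))"
        by (simp add: pole_sum_def sum_distrib_left sum_divide_distrib
            flip: sum.distrib add_divide_distrib)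
      also have "\<dots> = (\<Sum>s\<in>T. \<gamma> s / (1 + s * x) + (d s - e s * u) / (s - u) / (1 + u * x))"
      proof (rule sum.cong)
        fix s assume s: "s \<in> T"
        have "1 + s * x > 0" using one_plus_mult_pos[of s x] T s x by auto
        moreover have "s - u \<noteq> 0" using s insert by auto
        ultimately show "(e s + x * d s) / ((1 + s * x) * (1 + u * x))
            = \<gamma> s / (1 + s * x) + (d s - e s * u) / (s - u) / (1 + u * x)"
          using ux unfolding \<gamma>_def by (simp add: divide_simps) (simp add: algebra_simps)
      qed simp
      also have "\<dots> = pole_sum T \<gamma> x + \<delta> / (1 + u * x)"
        by (simp add: pole_sum_def \<delta>_def sum.distrib sum_divide_distrib)
      also have "pole_sum T \<gamma> x = pole_sum T (\<lambda>s. if s = u then \<delta> else \<gamma> s) x"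
        unfolding pole_sum_def using insert by (intro sum.cong) auto
      finally show ?thesis using insert by (simp add: pole_sum_def)
    qed
    then show ?thesis by blast
  qed
qed

section \<open>Integration against the weight\<close>

definition moment :: "(real \<Rightarrow> real) \<Rightarrow> (real \<Rightarrow> real) \<Rightarrow> real" where
  "moment w f = (LINT x:{-1..1}|lebesgue. f x * w x)"

lemma set_integrable_continuous_times_weight:
  fixes f :: "real \<Rightarrow> real"
  assumes "positive_weight w" "continuous_on {-1..1} f"
  shows "set_integrable lebesgue {-1..1} (\<lambda>x. f x * w x)"
proof (rule absolutely_integrable_bounded_measurable_product_real)
  show "f \<in> borel_measurable (lebesgue_on {-1..1})"
    using assms(2) by (intro continuous_imp_measurable_on_sets_lebesgue) auto
  show "bounded (f ` {-1..1})"
    using assms(2) by (simp add: compact_continuous_image compact_imp_bounded)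
qed (use assms(1) in \<open>auto simp: positive_weight_def\<close>)

lemma moment_add:
  assumes "positive_weight w" "continuous_on {-1..1} f" "continuous_on {-1..1} g"
  shows "moment w (\<lambda>x. f x + g x) = moment w f + moment w g"
  unfolding moment_def distrib_right
  using assms set_integrable_continuous_times_weight by (intro set_integral_add) auto

lemma moment_scale: "moment w (\<lambda>x. a * f x) = a * moment w f"
  unfolding moment_def by (simp add: mult.assoc)

lemma moment_times_pole_sum_eq_0:
  assumes "positive_weight w" "finite T" "T \<subseteq> {-1<..<1}" "continuous_on {-1..1} f"
    and "\<And>s. s \<in> T \<Longrightarrow> moment w (\<lambda>x. f x / (1 + s * x)) = 0"
  shows "moment w (\<lambda>x. f x * pole_sum T c x) = 0"
  using assms(2,3,5)
proof (induction T rule: finite_induct)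
  case empty
  then show ?case by (simp add: moment_def pole_sum_def)
next
  case (insert u T)
  have c1: "continuous_on {-1..1} (\<lambda>x. c u * (f x / (1 + u * x)))"
    using insert assms(4) one_plus_mult_pos[of u] by (intro continuous_intros) force+
  have c2: "continuous_on {-1..1} (\<lambda>x. f x * pole_sum T c x)"
    using insert assms(4) by (intro continuous_intros) auto
  have "moment w (\<lambda>x. f x * pole_sum (insert u T) c x)
      = moment w (\<lambda>x. c u * (f x / (1 + u * x)) + f x * pole_sum T c x)"
    using insert by (simp add: pole_sum_def algebra_simps)
  then show ?case
    using insert by (simp add: moment_add[OF assms(1) c1 c2] moment_scale del: times_divide_eq_right)
qed

lemma moment_pos:
  assumes w: "positive_weight w" and f: "continuous_on {-1..1} f"
    and nonneg: "\<And>x. x \<in> {-1..1} \<Longrightarrow> f x \<ge> 0" and fin: "finite (zeros f)"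
  shows "moment w f > 0"
proof -
  let ?h = "\<lambda>x. indicator {-1..1} x * (f x * w x) :: real"
  have wpos: "AE x in lebesgue. x \<in> {-1..1} \<longrightarrow> w x > 0"
    using w by (simp add: positive_weight_def)
  have int: "integrable lebesgue ?h"
    using set_integrable_continuous_times_weight[OF w f] by (simp add: set_integrable_def)
  have ge: "AE x in lebesgue. ?h x \<ge> 0"
    using wpos by eventually_elim (use nonneg in \<open>auto simp: indicator_def\<close>)
  have m: "moment w f = integral\<^sup>L lebesgue ?h"
    by (simp add: moment_def set_lebesgue_integral_def)
  have "moment w f \<noteq> 0"
  proof
    assume "moment w f = 0"
    then have ae: "AE x in lebesgue. ?h x = 0"
      using integral_nonneg_eq_0_iff_AE[OF int ge] m by simp
    have "AE x in lebesgue. x \<notin> zeros f"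
      using fin by (intro AE_not_in) (simp add: negligible_finite flip: negligible_iff_null_sets)
    with ae wpos have "AE x in lebesgue. x \<notin> {-1..1::real}"
      by eventually_elim (auto simp: zeros_def indicator_def split: if_splits)
    then have "{-1..1::real} \<in> null_sets lebesgue"
      by (simp add: AE_iff_null_sets)
    then show False by (auto simp: null_sets_def)
  qed
  moreover have "moment w f \<ge> 0" unfolding m using ge by (rule integral_nonneg_AE)
  ultimately show ?thesis by simp
qed

text \<open>Gram--Schmidt. To pass from \<open>T\<close> to \<open>insert u T\<close>, let \<open>f\<close> and \<open>g\<close> be \<open>\<phi>\<close> and the fraction of
  \<open>u\<close>, both made orthogonal to the span of \<open>T\<close>, and add to \<open>f\<close> the multiple of \<open>g\<close> that achieves
  orthogonality to the fraction of \<open>u\<close>. This is possible because the inner product of \<open>g\<close> with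
  that fraction equals that of \<open>g\<close> with itself, hence is positive.\<close>

lemma exists_orthogonal_projection:
  assumes w: "positive_weight w" and "finite T" "T \<subseteq> {-1<..<1}"
    and "continuous_on {-1..1} \<phi>"
  shows "\<exists>c. \<forall>u\<in>T. moment w (\<lambda>x. (\<phi> x + pole_sum T c x) / (1 + u * x)) = 0"
  using assms(2-4)
proof (induction T arbitrary: \<phi> rule: finite_induct)
  case empty
  then show ?case by simp
next
  case (insert u T)
  have T: "T \<subseteq> {-1<..<1}" and u: "u \<in> {-1<..<1}" using insert by auto
  have ne: "1 + s * x \<noteq> 0" if "s \<in> insert u T" "x \<in> {-1..1}" for s x
    using one_plus_mult_pos[of s x] insert.prems that by force
  have cu: "continuous_on {-1..1} (\<lambda>x. 1 / (1 + u * x))"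
    by (intro continuous_intros) (use ne in auto)
  obtain c where c: "\<And>s. s \<in> T \<Longrightarrow> moment w (\<lambda>x. (\<phi> x + pole_sum T c x) / (1 + s * x)) = 0"
    using insert.IH[OF T insert.prems(2)] by blast
  obtain d where d: "\<And>s. s \<in> T \<Longrightarrow>
      moment w (\<lambda>x. (1 / (1 + u * x) + pole_sum T d x) / (1 + s * x)) = 0"
    using insert.IH[OF T cu] by blast
  define f where "f x = \<phi> x + pole_sum T c x" for x
  define g where "g x = 1 / (1 + u * x) + pole_sum T d x" for x
  have cf: "continuous_on {-1..1} f" and cg: "continuous_on {-1..1} g"
    unfolding f_def g_def using insert.prems cu T by (auto intro!: continuous_intros)
  have g_eq: "g = pole_sum (insert u T) (d(u := 1))"
  proof
    fix x
    have "pole_sum T d x = pole_sum T (d(u := 1)) x"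
      unfolding pole_sum_def using insert by (intro sum.cong) auto
    then show "g x = pole_sum (insert u T) (d(u := 1)) x"
      using insert by (simp add: g_def pole_sum_def)
  qed
  have "finite (zeros g)"
    unfolding g_eq by (rule finite_zeros_pole_sum[of _ u]) (use insert in auto)
  then have "moment w (\<lambda>x. g x * g x) > 0"
    by (intro moment_pos[OF w] continuous_intros cg) (auto simp: zeros_def)
  also have "(\<lambda>x. g x * g x) = (\<lambda>x. g x / (1 + u * x) + g x * pole_sum T d x)"
  proof
    fix x
    have "g x * g x = g x * (1 / (1 + u * x) + pole_sum T d x)" by (simp only: g_def)
    then show "g x * g x = g x / (1 + u * x) + g x * pole_sum T d x"
      by (simp add: distrib_left)
  qed
  also have "moment w (\<lambda>x. g x / (1 + u * x) + g x * pole_sum T d x)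
      = moment w (\<lambda>x. g x / (1 + u * x)) + moment w (\<lambda>x. g x * pole_sum T d x)"
    by (intro moment_add[OF w] continuous_intros cg T) (use ne in auto)
  also have "moment w (\<lambda>x. g x * pole_sum T d x) = 0"
    using d by (intro moment_times_pole_sum_eq_0[OF w insert.hyps(1) T cg]) (simp add: g_def)
  finally have pos: "moment w (\<lambda>x. g x / (1 + u * x)) > 0" by simp
  define l where "l = - moment w (\<lambda>x. f x / (1 + u * x)) / moment w (\<lambda>x. g x / (1 + u * x))"
  define e where "e s = (if s = u then l else c s + l * d s)" for s
  have eq: "\<phi> x + pole_sum (insert u T) e x = f x + l * g x" for x
  proof -
    have "pole_sum T e x = (\<Sum>s\<in>T. c s / (1 + s * x) + l * (d s / (1 + s * x)))"
      unfolding pole_sum_def e_def using insert by (intro sum.cong) (auto simp: add_divide_distrib)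
    also have "\<dots> = pole_sum T c x + l * pole_sum T d x"
      by (simp add: pole_sum_def sum.distrib sum_distrib_left)
    finally show ?thesis
      using insert by (simp add: f_def g_def pole_sum_def e_def algebra_simps)
  qed
  have "moment w (\<lambda>x. (\<phi> x + pole_sum (insert u T) e x) / (1 + s * x)) = 0"
    if s: "s \<in> insert u T" for s
  proof -
    have "moment w (\<lambda>x. (\<phi> x + pole_sum (insert u T) e x) / (1 + s * x))
        = moment w (\<lambda>x. f x / (1 + s * x) + l * (g x / (1 + s * x)))"
      by (simp add: eq add_divide_distrib)
    also have "\<dots> = moment w (\<lambda>x. f x / (1 + s * x)) + moment w (\<lambda>x. l * (g x / (1 + s * x)))"
      by (intro moment_add[OF w] continuous_intros cf cg) (use ne s in auto)
    also have "\<dots> = moment w (\<lambda>x. f x / (1 + s * x)) + l * moment w (\<lambda>x. g x / (1 + s * x))"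
      by (simp only: moment_scale)
    also have "\<dots> = 0"
    proof (cases "s = u")
      case True
      then show ?thesis using pos by (simp add: l_def)
    next
      case False
      then show ?thesis using s c[of s] d[of s] by (simp add: f_def g_def)
    qed
    finally show ?thesis .
  qed
  then show ?case by blast
qed

section \<open>Interlacing of orthogonal functions\<close>

lemma pole_num_lincomb:
  "smult \<alpha> (pole_num S a) + smult \<beta> (pole_num S b) = pole_num S (\<lambda>u. \<alpha> * a u + \<beta> * b u)"
  by (rule poly_eqI)
    (simp add: pole_num_def coeff_sum sum_distrib_left sum.distrib algebra_simps)

lemma pole_sum_lincomb:
  "pole_sum S (\<lambda>u. \<alpha> * a u + \<beta> * b u) x = \<alpha> * pole_sum S a x + \<beta> * pole_sum S b x"
  by (simp add: pole_sum_def sum_distrib_left add_divide_distrib sum.distrib)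

lemma square_dvd_if_double_root:
  fixes p :: "real poly"
  assumes "poly p x = 0" "poly (pderiv p) x = 0"
  obtains q where "p = [:-x, 1:]\<^sup>2 * q"
proof -
  obtain r where r: "p = [:-x, 1:] * r" using assms(1) by (auto simp: poly_eq_0_iff_dvd dvd_def)
  have "poly (pderiv p) x = poly r x" unfolding r pderiv_mult by (simp add: pderiv_pCons)
  then obtain q where "r = [:-x, 1:] * q" using assms(2) by (auto simp: poly_eq_0_iff_dvd dvd_def)
  then show thesis using r that[of q] by (simp only: power2_eq_square mult.assoc)
qed

text \<open>The heart of the proof: were \<open>(x - y)\<^sup>2\<close> a factor of the numerator, its cofactor \<open>q\<close>, put over
  the denominator of \<open>T\<close>, would be a test function in the span of \<open>T\<close> whose product with the sum
  is nonnegative. The bound on \<open>card S\<close> is what makes \<open>degree q < card T\<close>.\<close>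

lemma no_double_root_if_orthogonal:
  assumes w: "positive_weight w"
    and S: "finite S" "S \<subseteq> {-1<..<1}" and T: "finite T" "T \<subseteq> {-1<..<1}"
    and card: "card S \<le> card T + 2"
    and ne: "u \<in> S" "c u \<noteq> 0"
    and orth: "\<And>s. s \<in> T \<Longrightarrow> moment w (\<lambda>x. pole_sum S c x / (1 + s * x)) = 0"
    and root: "poly (pole_num S c) y = 0" "poly (pderiv (pole_num S c)) y = 0"
  shows False
proof -
  obtain q where q: "pole_num S c = [:-y, 1:]\<^sup>2 * q"
    using square_dvd_if_double_root[OF root] by blast
  have fin: "finite (zeros (pole_sum S c))"
    by (rule finite_zeros_pole_sum[of S u c, OF S(1) ne S(2)])
  have "q \<noteq> 0"
  proof
    assume "q = 0"
    then have "{-1..1} \<subseteq> zeros (pole_sum S c)"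
      using pole_sum_eq_quotient[OF S] q by (auto simp: zeros_def)
    then show False using fin by (meson finite_subset infinite_Icc_iff neg_less_iff_less
          less_trans zero_less_one neg_less_0_iff_less)
  qed
  then have "degree (pole_num S c) = 2 + degree q"
    unfolding q by (subst degree_mult_eq) (auto simp: degree_power_eq)
  then have deg: "degree q < card T"
    using degree_pole_num[OF S(1), of c] card by linarith
  obtain d where d: "\<And>x. x \<in> {-1..1} \<Longrightarrow> poly q x / poly (pole_den T) x = pole_sum T d x"
    using partial_fractions[OF T deg] by blast
  have prod: "pole_sum S c x * pole_sum T d x
      = (x - y)\<^sup>2 * (poly q x)\<^sup>2 / (poly (pole_den S) x * poly (pole_den T) x)"
    if "x \<in> {-1..1}" for x
    unfolding d[OF that, symmetric] pole_sum_eq_quotient[OF S that, of c] q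
    by (simp add: power2_eq_square) (simp add: algebra_simps)
  have "moment w (\<lambda>x. pole_sum S c x * pole_sum T d x) > 0"
  proof (rule moment_pos[OF w])
    show "continuous_on {-1..1} (\<lambda>x. pole_sum S c x * pole_sum T d x)"
      using S T by (intro continuous_intros)
    show "pole_sum S c x * pole_sum T d x \<ge> 0" if x: "x \<in> {-1..1}" for x
      using pole_den_pos[OF S(2) x] pole_den_pos[OF T(2) x] by (simp add: prod[OF x])
    have "zeros (\<lambda>x. pole_sum S c x * pole_sum T d x) \<subseteq> insert y {x. poly q x = 0}"
    proof
      fix x assume z: "x \<in> zeros (\<lambda>x. pole_sum S c x * pole_sum T d x)"
      then have x: "x \<in> {-1..1}" by (simp add: zeros_def)
      show "x \<in> insert y {x. poly q x = 0}"
        using z prod[OF x] pole_den_pos[OF S(2) x] pole_den_pos[OF T(2) x]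
        by (auto simp: zeros_def)
    qed
    then show "finite (zeros (\<lambda>x. pole_sum S c x * pole_sum T d x))"
      using poly_roots_finite[OF \<open>q \<noteq> 0\<close>] by (meson finite.insertI finite_subset)
  qed
  moreover have "moment w (\<lambda>x. pole_sum S c x * pole_sum T d x) = 0"
    using orth by (intro moment_times_pole_sum_eq_0[OF w T] continuous_intros S)
  ultimately show False by simp
qed

lemma strictly_interlacing_if_orthogonal:
  assumes w: "positive_weight w"
    and S: "finite S" "S \<subseteq> {-1<..<1}" and T: "finite T" "T \<subseteq> {-1<..<1}"
    and card: "card S \<le> card T + 2"
    and indep: "\<And>\<alpha> \<beta>. (\<And>u. u \<in> S \<Longrightarrow> \<alpha> * a u + \<beta> * b u = 0) \<Longrightarrow> \<alpha> = 0 \<and> \<beta> = 0"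
    and a: "\<And>s. s \<in> T \<Longrightarrow> moment w (\<lambda>x. pole_sum S a x / (1 + s * x)) = 0"
    and b: "\<And>s. s \<in> T \<Longrightarrow> moment w (\<lambda>x. pole_sum S b x / (1 + s * x)) = 0"
  shows "strictly_interlacing (zeros (pole_sum S a)) (zeros (pole_sum S b))"
proof -
  let ?F = "pole_num S a" and ?G = "pole_num S b"
  have simple: False
    if ne: "\<alpha> \<noteq> 0 \<or> \<beta> \<noteq> 0"
      and root: "\<alpha> * poly ?F y + \<beta> * poly ?G y = 0"
        "\<alpha> * poly (pderiv ?F) y + \<beta> * poly (pderiv ?G) y = 0"
    for \<alpha> \<beta> y
  proof -
    let ?c = "\<lambda>u. \<alpha> * a u + \<beta> * b u"
    obtain u where u: "u \<in> S" "?c u \<noteq> 0" using indep ne by blast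
    have "moment w (\<lambda>x. pole_sum S ?c x / (1 + s * x)) = 0" if s: "s \<in> T" for s
    proof -
      have nz: "1 + s * x \<noteq> 0" if "x \<in> {-1..1}" for x
        using one_plus_mult_pos[of s x] that s T by force
      have "moment w (\<lambda>x. pole_sum S ?c x / (1 + s * x))
          = moment w (\<lambda>x. \<alpha> * (pole_sum S a x / (1 + s * x)) + \<beta> * (pole_sum S b x / (1 + s * x)))"
        by (simp add: pole_sum_lincomb add_divide_distrib)
      also have "\<dots> = moment w (\<lambda>x. \<alpha> * (pole_sum S a x / (1 + s * x)))
          + moment w (\<lambda>x. \<beta> * (pole_sum S b x / (1 + s * x)))"
        by (intro moment_add[OF w] continuous_intros S) (use nz in auto)
      also have "\<dots> = 0" unfolding moment_scale a[OF s] b[OF s] by simp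
      finally show ?thesis .
    qed
    then show False
      by (rule no_double_root_if_orthogonal[of w S T u ?c y, OF w S T card u])
        (use root in \<open>simp_all add: pderiv_add pderiv_smult flip: pole_num_lincomb\<close>)
  qed
  \<comment> \<open>A zero of the Wronskian at \<open>y\<close> makes the linear system for a combination with a double root
    at \<open>y\<close> singular. The three uses of \<open>simple\<close> exhibit a nontrivial solution, according to which
    entries of its matrix vanish.\<close>
  have W: "poly ?F y * poly (pderiv ?G) y - poly (pderiv ?F) y * poly ?G y \<noteq> 0" for y
  proof
    assume W0: "poly ?F y * poly (pderiv ?G) y - poly (pderiv ?F) y * poly ?G y = 0"
    have "poly ?F y = 0" "poly ?G y = 0"
      using simple[of "poly ?G y" "- poly ?F y" y] W0 by (auto simp: algebra_simps)
    moreover from this have "poly (pderiv ?F) y = 0"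
      using simple[of "poly (pderiv ?G) y" "- poly (pderiv ?F) y" y] by (auto simp: algebra_simps)
    ultimately show False using simple[of 1 0 y] by simp
  qed
  have "zeros (pole_sum S c) = zeros (poly (pole_num S c))" for c
    using pole_sum_eq_quotient[OF S, of _ c] pole_den_pos[OF S(2)]
    unfolding zeros_def by force
  then show ?thesis using strictly_interlacing_if_Wronskian_nonzero[OF W] by simp
qed

text \<open>Describes the chosen function by coefficients indexed by the parameters themselves instead of
  their positions, and extended by 0. Functions built from differently ordered or different
  parameters can then be compared as sums over one common set \<open>S\<close>.\<close>

lemma orth_rat_eq_pole_sum:
  fixes s :: "nat \<Rightarrow> real"
  assumes w: "positive_weight w" and "m \<ge> 1"
    and s: "s ` {1..m} \<subseteq> {-1<..<1}" "inj_on s {1..m}"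
  obtains a where "a (s m) = 1" "\<And>u. u \<notin> s ` {1..m} \<Longrightarrow> a u = 0"
    "\<And>S. finite S \<Longrightarrow> s ` {1..m} \<subseteq> S \<Longrightarrow> orth_rat w m s = pole_sum S a"
    "\<And>u. u \<in> s ` {1..m - 1} \<Longrightarrow> moment w (\<lambda>x. orth_rat w m s x / (1 + u * x)) = 0"
proof -
  let ?T = "s ` {1..m - 1}"
  have sub: "{1..m - 1} \<subseteq> {1..m}" by auto
  have inj: "inj_on s {1..m - 1}" using inj_on_subset[OF s(2) sub] .
  have T: "finite ?T" "?T \<subseteq> {-1<..<1}" using s(1) image_mono[OF sub, of s] by auto
  have sm: "s m \<in> {-1<..<1}" using \<open>m \<ge> 1\<close> by (intro subsetD[OF s(1)]) auto
  have "continuous_on {-1..1} (\<lambda>x. 1 / (1 + s m * x))"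
    by (intro continuous_intros) (use one_plus_mult_pos[OF sm] in force)
  then obtain d where d: "\<And>u. u \<in> ?T \<Longrightarrow>
      moment w (\<lambda>x. (1 / (1 + s m * x) + pole_sum ?T d x) / (1 + u * x)) = 0"
    using exists_orthogonal_projection[OF w T] by blast
  have orth_iff: "orth_coeffs w m s c \<longleftrightarrow>
      (\<forall>u\<in>?T. moment w (\<lambda>x. rat_comb m s c x / (1 + u * x)) = 0)" for c
    by (simp add: orth_coeffs_def moment_def)
  have "rat_comb m s (d \<circ> s) x = 1 / (1 + s m * x) + pole_sum ?T d x" for x
    by (simp add: rat_comb_def pole_sum_def sum.reindex[OF inj] del: One_nat_def)
  then have "orth_coeffs w m s (d \<circ> s)" using d by (simp add: orth_iff)
  then have orth: "orth_coeffs w m s (SOME c. orth_coeffs w m s c)"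
    by (rule someI[of "orth_coeffs w m s"])
  define c where "c = (SOME c. orth_coeffs w m s c)"
  define a where "a u = (if u \<in> ?T then c (inv_into {1..m - 1} s u)
    else if u = s m then 1 else 0)" for u
  have img: "s ` {1..m} = insert (s m) ?T"
    using \<open>m \<ge> 1\<close> by (cases m) (auto simp: atLeastAtMostSuc_conv)
  have smT: "s m \<notin> ?T"
    using inj_on_image_mem_iff[OF s(2) _ sub, of m] \<open>m \<ge> 1\<close> by auto
  have a_out: "a u = 0" if "u \<notin> s ` {1..m}" for u
    using that unfolding img a_def by simp
  show thesis
  proof (rule that[of a])
    show "a (s m) = 1" using smT by (simp add: a_def)
    show "a u = 0" if "u \<notin> s ` {1..m}" for u using a_out[OF that] .
    show "orth_rat w m s = pole_sum S a" if S: "finite S" "s ` {1..m} \<subseteq> S" for S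
    proof
      fix x
      have "pole_sum S a x = pole_sum (s ` {1..m}) a x"
        unfolding pole_sum_def using S
        by (intro sum.mono_neutral_right) (auto simp: a_out)
      also have "\<dots> = 1 / (1 + s m * x) + (\<Sum>j = 1..m - 1. a (s j) / (1 + s j * x))"
        using smT by (simp add: img pole_sum_def sum.reindex[OF inj] a_def del: One_nat_def)
      also have "(\<Sum>j = 1..m - 1. a (s j) / (1 + s j * x)) = (\<Sum>j = 1..m - 1. c j / (1 + s j * x))"
        by (intro sum.cong) (auto simp: a_def inv_into_f_f[OF inj] simp del: One_nat_def)
      finally show "orth_rat w m s x = pole_sum S a x"
        by (simp add: orth_rat_def rat_comb_def c_def)
    qed
    show "moment w (\<lambda>x. orth_rat w m s x / (1 + u * x)) = 0" if "u \<in> ?T" for u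
      using orth that unfolding orth_rat_def orth_iff by blast
  qed
qed

theorem mainTheorem3:
  fixes w :: "real \<Rightarrow> real" and n :: nat and t :: "nat \<Rightarrow> real"
  assumes "positive_weight w"
    and "n \<ge> 1"
    and "\<forall>j \<in> {1..n + 1}. t j \<in> {-1<..<1}"
    and "inj_on t {1..n + 1}"
  shows "strictly_interlacing (zeros (orth_rat w n t)) (zeros (orth_rat w (n + 1) t))
    \<and> strictly_interlacing (zeros (orth_rat w n t)) (zeros (orth_rat w n (t(n := t (n + 1)))))
    \<and> (\<forall>i \<in> {1..n - 1}.
         strictly_interlacing
           (zeros (orth_rat w n (\<lambda>j. if j < i then t j else if j < n then t (j + 1) else t i)))
           (zeros (orth_rat w n t)))"
proof (intro conjI ballI)
  note w = assms(1)
  let ?S = "t ` {1..n + 1}" and ?T = "t ` {1..n - 1}"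
  have inj: "inj_on t A" if "A \<subseteq> {1..n + 1}" for A using inj_on_subset[OF assms(4) that] .
  have mem: "t j \<in> t ` A \<longleftrightarrow> j \<in> A" if "j \<in> {1..n + 1}" "A \<subseteq> {1..n + 1}" for j A
    using inj_on_image_mem_iff[OF assms(4) that] .
  have unit: "t ` A \<subseteq> {-1<..<1}" if "A \<subseteq> {1..n + 1}" for A using assms(3) that by blast
  have card: "card (t ` A) = card A" if "A \<subseteq> {1..n + 1}" for A using card_image[OF inj[OF that]] .
  have sub: "{1..n - 1} \<subseteq> {1..n + 1}" by auto
  have T: "finite ?T" "?T \<subseteq> {-1<..<1}" "card ?S \<le> card ?T + 2"
    using card[OF order_refl] card[OF sub] unit[OF sub] by auto
  have S: "finite ?S" "?S \<subseteq> {-1<..<1}" by (auto simp: unit)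
  have n_mem: "t n \<in> ?S" "t (n + 1) \<in> ?S" using \<open>n \<ge> 1\<close> by auto
  obtain a where a: "a (t n) = 1" "\<And>u. u \<notin> t ` {1..n} \<Longrightarrow> a u = 0"
    "\<And>S. finite S \<Longrightarrow> t ` {1..n} \<subseteq> S \<Longrightarrow> orth_rat w n t = pole_sum S a"
    "\<And>u. u \<in> ?T \<Longrightarrow> moment w (\<lambda>x. orth_rat w n t x / (1 + u * x)) = 0"
    by (rule orth_rat_eq_pole_sum[OF w \<open>n \<ge> 1\<close> unit inj]) auto
  have a_next: "a (t (n + 1)) = 0" using a(2) mem[of "n + 1" "{1..n}"] by auto
  have aS: "orth_rat w n t = pole_sum ?S a" by (rule a(3)) auto

  show "strictly_interlacing (zeros (orth_rat w n t)) (zeros (orth_rat w (n + 1) t))"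
  proof -
    obtain b where b: "b (t (n + 1)) = 1"
      "\<And>S. finite S \<Longrightarrow> t ` {1..n + 1} \<subseteq> S \<Longrightarrow> orth_rat w (n + 1) t = pole_sum S b"
      "\<And>u. u \<in> t ` {1..n + 1 - 1} \<Longrightarrow> moment w (\<lambda>x. orth_rat w (n + 1) t x / (1 + u * x)) = 0"
      by (rule orth_rat_eq_pole_sum[OF w le_add2 S(2) assms(4)]) blast
    have bS: "orth_rat w (n + 1) t = pole_sum ?S b" by (rule b(2)) auto
    show ?thesis unfolding aS bS
    proof (rule strictly_interlacing_if_orthogonal[OF w S T])
      fix \<alpha> \<beta> assume "\<And>u. u \<in> ?S \<Longrightarrow> \<alpha> * a u + \<beta> * b u = 0"
      from this[OF n_mem(1)] this[OF n_mem(2)] show "\<alpha> = 0 \<and> \<beta> = 0"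
        using a(1) a_next b(1) by simp
    next
      fix u assume u: "u \<in> ?T"
      show "moment w (\<lambda>x. pole_sum ?S a x / (1 + u * x)) = 0" using a(4)[OF u] unfolding aS .
      have "u \<in> t ` {1..n + 1 - 1}" using u by auto
      from b(3)[OF this] show "moment w (\<lambda>x. pole_sum ?S b x / (1 + u * x)) = 0" unfolding bS .
    qed
  qed

  show "strictly_interlacing (zeros (orth_rat w n t)) (zeros (orth_rat w n (t(n := t (n + 1)))))"
  proof -
    let ?s = "t(n := t (n + 1))"
    have s_n: "?s ` {1..n} = t ` ({1..n + 1} - {n})"
    proof -
      have "{1..n + 1} - {n} = insert (n + 1) {1..n - 1}" using \<open>n \<ge> 1\<close> by auto
      moreover have "{1..n} = insert n {1..n - 1}" using \<open>n \<ge> 1\<close> by auto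
      moreover have "?s ` {1..n - 1} = t ` {1..n - 1}" by (intro image_cong) auto
      ultimately show ?thesis by (simp only: image_insert fun_upd_same)
    qed
    have s_T: "?s ` {1..n - 1} = ?T" by (intro image_cong) auto
    have "card (?s ` {1..n}) = card ({1..n + 1} - {n})" unfolding s_n by (rule card) auto
    then have inj_s: "inj_on ?s {1..n}"
      using \<open>n \<ge> 1\<close> by (intro eq_card_imp_inj_on) simp_all
    have unit_s: "?s ` {1..n} \<subseteq> {-1<..<1}" unfolding s_n by (rule unit) auto
    obtain b where b: "b (?s n) = 1" "\<And>u. u \<notin> ?s ` {1..n} \<Longrightarrow> b u = 0"
      "\<And>S. finite S \<Longrightarrow> ?s ` {1..n} \<subseteq> S \<Longrightarrow> orth_rat w n ?s = pole_sum S b"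
      "\<And>u. u \<in> ?s ` {1..n - 1} \<Longrightarrow> moment w (\<lambda>x. orth_rat w n ?s x / (1 + u * x)) = 0"
      by (rule orth_rat_eq_pole_sum[OF w \<open>n \<ge> 1\<close> unit_s inj_s]) blast
    have b_next: "b (t (n + 1)) = 1" using b(1) by simp
    have bS: "orth_rat w n ?s = pole_sum ?S b" by (rule b(3)) (auto simp: s_n)
    have b_n: "b (t n) = 0"
      using b(2)[of "t n"] mem[of n "{1..n + 1} - {n}"] \<open>n \<ge> 1\<close> unfolding s_n by auto
    show ?thesis unfolding aS bS
    proof (rule strictly_interlacing_if_orthogonal[OF w S T])
      fix \<alpha> \<beta> assume "\<And>u. u \<in> ?S \<Longrightarrow> \<alpha> * a u + \<beta> * b u = 0"
      from this[OF n_mem(1)] this[OF n_mem(2)] show "\<alpha> = 0 \<and> \<beta> = 0"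
        using a(1) a_next b_next b_n by simp
    next
      fix u assume u: "u \<in> ?T"
      show "moment w (\<lambda>x. pole_sum ?S a x / (1 + u * x)) = 0" using a(4)[OF u] unfolding aS .
      show "moment w (\<lambda>x. pole_sum ?S b x / (1 + u * x)) = 0"
        using b(4)[unfolded s_T, OF u] unfolding bS .
    qed
  qed

  fix i assume i: "i \<in> {1..n - 1}"
  let ?s = "\<lambda>j. if j < i then t j else if j < n then t (j + 1) else t i"
  let ?R = "t ` {1..n}" and ?U = "t ` ({1..n - 1} - {i})"
  show "strictly_interlacing (zeros (orth_rat w n ?s)) (zeros (orth_rat w n t))"
  proof -
    have R: "finite ?R" "?R \<subseteq> {-1<..<1}" using unit[of "{1..n}"] by auto
    have U: "finite ?U" "?U \<subseteq> {-1<..<1}" using T by auto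
    have cardU: "card ?R \<le> card ?U + 2"
    proof -
      have "card ?U = card ({1..n - 1} - {i})" by (rule card) auto
      moreover have "card ?R = card {1..n}" by (rule card) auto
      ultimately show ?thesis using i by simp
    qed
    have s_butlast: "?s ` {1..n - 1} = t ` ({1..n} - {i})"
    proof -
      \<comment> \<open>the increasing enumeration of the indices other than \<open>i\<close>\<close>
      define \<pi> where "\<pi> j = (if j < i then j else j + 1)" for j
      have "?s ` {1..n - 1} = t ` \<pi> ` {1..n - 1}"
        unfolding image_image by (intro image_cong) (auto simp: \<pi>_def)
      also have "\<pi> ` {1..n - 1} = {1..n} - {i}"
      proof (intro subset_antisym subsetI)
        fix j assume j: "j \<in> {1..n} - {i}"
        show "j \<in> \<pi> ` {1..n - 1}"
        proof (cases "j < i")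
          case True
          then show ?thesis using i j by (intro image_eqI[of _ _ j]) (auto simp: \<pi>_def)
        next
          case False
          then show ?thesis using i j by (intro image_eqI[of _ _ "j - 1"]) (auto simp: \<pi>_def)
        qed
      qed (use i in \<open>auto simp: \<pi>_def split: if_splits\<close>)
      finally show ?thesis .
    qed
    have s_n: "?s n = t i" using i by auto
    have s_R: "?s ` {1..n} = ?R"
    proof -
      have "{1..n} = insert n {1..n - 1}" using \<open>n \<ge> 1\<close> by auto
      then have "?s ` {1..n} = insert (t i) (t ` ({1..n} - {i}))"
        by (simp only: image_insert s_butlast s_n)
      also have "\<dots> = t ` insert i ({1..n} - {i})" by (simp only: image_insert)
      also have "insert i ({1..n} - {i}) = {1..n}" using i by auto
      finally show ?thesis .
    qed
    have inj_s: "inj_on ?s {1..n}"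
      unfolding inj_on_iff_eq_card[OF finite_atLeastAtMost] s_R by (simp add: card)
    have unit_s: "?s ` {1..n} \<subseteq> {-1<..<1}" unfolding s_R by (rule R)
    obtain b where b: "b (?s n) = 1"
      "\<And>S. finite S \<Longrightarrow> ?s ` {1..n} \<subseteq> S \<Longrightarrow> orth_rat w n ?s = pole_sum S b"
      "\<And>u. u \<in> ?s ` {1..n - 1} \<Longrightarrow> moment w (\<lambda>x. orth_rat w n ?s x / (1 + u * x)) = 0"
      by (rule orth_rat_eq_pole_sum[OF w \<open>n \<ge> 1\<close> unit_s inj_s]) blast
    have bR: "orth_rat w n ?s = pole_sum ?R b" by (rule b(2)[unfolded s_R, OF R(1) order_refl])
    have aR: "orth_rat w n t = pole_sum ?R a" by (rule a(3)) auto
    have b_orth: "moment w (\<lambda>x. pole_sum ?R b x / (1 + u * x)) = 0" if "u \<in> t ` ({1..n} - {i})" for u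
      using b(3)[of u] that unfolding s_butlast bR by blast
    have i_T: "t i \<in> ?T" using i by blast
    have a_orth: "moment w (\<lambda>x. pole_sum ?R a x / (1 + u * x)) = 0" if "u \<in> ?T" for u
      using a(4)[OF that] unfolding aR .
    show ?thesis unfolding aR bR
    proof (rule strictly_interlacing_if_orthogonal[OF w R U cardU])
      fix \<alpha> \<beta> assume dep: "\<And>u. u \<in> ?R \<Longrightarrow> \<alpha> * b u + \<beta> * a u = 0"
      have tn: "t n \<in> ?R" and ti: "t i \<in> ?R" using \<open>n \<ge> 1\<close> i by auto
      \<comment> \<open>Otherwise the two functions are proportional. One of them is orthogonal to all
        fractions but that of \<open>t i\<close>, the other to that of \<open>t i\<close>, so the first would be
        orthogonal to itself.\<close>
      have "\<alpha> = 0"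
      proof (rule ccontr)
        assume "\<alpha> \<noteq> 0"
        then have ba: "b u = (- \<beta> / \<alpha>) * a u" if "u \<in> ?R" for u
          using dep[OF that] by (simp add: field_simps)
        have proportional: "pole_sum ?R b x = (- \<beta> / \<alpha>) * pole_sum ?R a x" for x
          unfolding pole_sum_def sum_distrib_left
          by (intro sum.cong refl) (simp add: ba)
        have all: "moment w (\<lambda>x. pole_sum ?R b x / (1 + u * x)) = 0" if u: "u \<in> ?R" for u
        proof (cases "u = t i")
          case False
          then show ?thesis using u by (intro b_orth) auto
        next
          case True
          have "moment w (\<lambda>x. pole_sum ?R b x / (1 + u * x))
              = moment w (\<lambda>x. (- \<beta> / \<alpha>) * (pole_sum ?R a x / (1 + u * x)))"
            unfolding proportional by (simp only: times_divide_eq_right)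
          also have "\<dots> = 0"
            unfolding moment_scale using a_orth[OF i_T] True by simp
          finally show ?thesis .
        qed
        have "finite (zeros (pole_sum ?R b))"
          by (rule finite_zeros_pole_sum[OF R(1) ti _ R(2)]) (simp add: b(1)[unfolded s_n])
        then have "moment w (\<lambda>x. pole_sum ?R b x * pole_sum ?R b x) > 0"
          by (intro moment_pos[OF w] continuous_intros R) (auto simp: zeros_def)
        then show False
          using moment_times_pole_sum_eq_0[OF w R _ all, of b] continuous_on_pole_sum[OF R(2)]
          by auto
      qed
      then show "\<alpha> = 0 \<and> \<beta> = 0" using dep[OF tn] a(1) by simp
    next
      fix u assume u: "u \<in> ?U"
      show "moment w (\<lambda>x. pole_sum ?R b x / (1 + u * x)) = 0"
        by (rule b_orth, rule subsetD[OF image_mono u]) auto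
      show "moment w (\<lambda>x. pole_sum ?R a x / (1 + u * x)) = 0"
        by (rule a_orth, rule subsetD[OF image_mono u]) auto
    qed
  qed
qed

end
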